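(* Let $x_{\text{jopt}}$ and $x_{\text{mopt}}$ be the job-optimal and the machine-optimal relaxed unsplit stable assignments of an instance, and let $m$ be a machine. (i) If $x_{\text{mopt}}(m)<q(m)$, then $x(m)<q(m)$ for every relaxed unsplit stable assignment $x$. (ii) If $x_{\text{jopt}}(m)>q(m)$, then $x(m)\ge q(m)$ for every relaxed unsplit stable assignment $x$.
   Context: An instance consists of a finite bipartite graph $G=(J\cup M,E)$ between jobs $J$ and machines $M$; each job $j$ has size $q(j)>0$, each machine $m$ capacity $q(m)>0$; each job strictly ranks its adjacent machines and each machine strictly ranks its adjacent jobs. $M$ contains a dummy machine $m_d$ adjacent to every job, ranked last by every job, with $q(m_d)>\sum_{j\in J}q(j)$. An assignment is $x:E\to\mathbb{R}_{\ge0}$, $x(j)=\sum_m x(jm)$, $x(m)=\sum_j x(jm)$. It is unsplit if $x(jm)\in\{0,q(j)\}$ for all $jm$ and $x(j)\le q(j)$ for all $j$. An unsplit $x$ is a relaxed unsplit assignment if for every machine $m$ with at least one assigned job, $x(m)-q(j_m)<q(m)$, where $j_m$ is the assigned job $m$ likes least. A relaxed unsplit assignment $x$ is stable if for every edge $jm$ with $x(jm)=0$, either $j$ is assigned to a machine it prefers to $m$, or $\sum_{j':m\text{ prefers } j'\text{ to } j}x(j'm)\ge q(m)$. For unsplit $x_1,x_2$: job $j$ weakly prefers $x_1$ to $x_2$ if its machine in $x_1$ is equal to or preferred by $j$ to its machine in $x_2$; machine $m$ weakly prefers $x_1$ to $x_2$ if either no edge incident to $m$ is positive in exactly one of $x_1,x_2$,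 or the edge $m$ ranks best among those incident edges positive in exactly one of them is positive in $x_1$. The job-optimal (machine-optimal) relaxed unsplit stable assignment $x_{\text{jopt}}$ ($x_{\text{mopt}}$) is the (existing) relaxed unsplit stable assignment that every job (machine) weakly prefers to every relaxed unsplit stable assignment. *)

theory Defs
  imports Complex_Main
begin

(* jpref I j m m' reads "job j prefers machine m to machine m'", and
   mpref I m j j' reads "machine m prefers job j to job j'". *)
record ('j, 'm) alloc_instance =
  jobs :: "'j set"
  machines :: "'m set"
  edges :: "('j \<times> 'm) set"
  jsize :: "'j \<Rightarrow> real"
  capacity :: "'m \<Rightarrow> real"
  jpref :: "'j \<Rightarrow> 'm \<Rightarrow> 'm \<Rightarrow> bool"
  mpref :: "'m \<Rightarrow> 'j \<Rightarrow> 'j \<Rightarrow> bool"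
  dummy :: "'m"

definition job_nbrs :: "('j, 'm) alloc_instance \<Rightarrow> 'j \<Rightarrow> 'm set" where
  "job_nbrs I j = {m. (j, m) \<in> edges I}"

definition mach_nbrs :: "('j, 'm) alloc_instance \<Rightarrow> 'm \<Rightarrow> 'j set" where
  "mach_nbrs I m = {j. (j, m) \<in> edges I}"

definition strict_ranking_on :: "'a set \<Rightarrow> ('a \<Rightarrow> 'a \<Rightarrow> bool) \<Rightarrow> bool" where
  "strict_ranking_on A R \<longleftrightarrow> irreflp_on A R \<and> transp_on A R \<and> totalp_on A R"

definition valid_instance :: "('j, 'm) alloc_instance \<Rightarrow> bool" where
  "valid_instance I \<longleftrightarrow>
     finite (jobs I) \<and> finite (machines I) \<and> edges I \<subseteq> jobs I \<times> machines I \<and>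
     (\<forall>j\<in>jobs I. 0 < jsize I j) \<and>
     (\<forall>m\<in>machines I. 0 < capacity I m) \<and>
     (\<forall>j\<in>jobs I. strict_ranking_on (job_nbrs I j) (jpref I j)) \<and>
     (\<forall>m\<in>machines I. strict_ranking_on (mach_nbrs I m) (mpref I m)) \<and>
     dummy I \<in> machines I \<and>
     (\<forall>j\<in>jobs I. (j, dummy I) \<in> edges I) \<and>
     (\<forall>j\<in>jobs I. \<forall>m\<in>job_nbrs I j. m \<noteq> dummy I \<longrightarrow> jpref I j m (dummy I)) \<and>
     (\<Sum>j\<in>jobs I. jsize I j) < capacity I (dummy I)"

(* Assignments are total functions on pairs, but every notion below reads
   their values only on edges, so the values elsewhere are irrelevant. *)

definition job_load :: "('j, 'm) alloc_instance \<Rightarrow> ('j \<times> 'm \<Rightarrow> real) \<Rightarrow> 'j \<Rightarrow> real" where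
  "job_load I x j = (\<Sum>m\<in>job_nbrs I j. x (j, m))"

definition mach_load :: "('j, 'm) alloc_instance \<Rightarrow> ('j \<times> 'm \<Rightarrow> real) \<Rightarrow> 'm \<Rightarrow> real" where
  "mach_load I x m = (\<Sum>j\<in>mach_nbrs I m. x (j, m))"

definition is_assignment :: "('j, 'm) alloc_instance \<Rightarrow> ('j \<times> 'm \<Rightarrow> real) \<Rightarrow> bool" where
  "is_assignment I x \<longleftrightarrow> (\<forall>e\<in>edges I. 0 \<le> x e)"

definition unsplit :: "('j, 'm) alloc_instance \<Rightarrow> ('j \<times> 'm \<Rightarrow> real) \<Rightarrow> bool" where
  "unsplit I x \<longleftrightarrow>
     is_assignment I x \<and>
     (\<forall>(j, m)\<in>edges I. x (j, m) \<in> {0, jsize I j}) \<and>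
     (\<forall>j\<in>jobs I. job_load I x j \<le> jsize I j)"

definition assigned_jobs :: "('j, 'm) alloc_instance \<Rightarrow> ('j \<times> 'm \<Rightarrow> real) \<Rightarrow> 'm \<Rightarrow> 'j set" where
  "assigned_jobs I x m = {j \<in> mach_nbrs I m. 0 < x (j, m)}"

definition assigned_machines :: "('j, 'm) alloc_instance \<Rightarrow> ('j \<times> 'm \<Rightarrow> real) \<Rightarrow> 'j \<Rightarrow> 'm set" where
  "assigned_machines I x j = {m \<in> job_nbrs I j. 0 < x (j, m)}"

definition least_liked_job :: "('j, 'm) alloc_instance \<Rightarrow> ('j \<times> 'm \<Rightarrow> real) \<Rightarrow> 'm \<Rightarrow> 'j" where
  "least_liked_job I x m =
     (THE j. j \<in> assigned_jobs I x m \<and>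
             (\<forall>j'\<in>assigned_jobs I x m. j' \<noteq> j \<longrightarrow> mpref I m j' j))"

definition relaxed_unsplit :: "('j, 'm) alloc_instance \<Rightarrow> ('j \<times> 'm \<Rightarrow> real) \<Rightarrow> bool" where
  "relaxed_unsplit I x \<longleftrightarrow>
     unsplit I x \<and>
     (\<forall>m\<in>machines I. assigned_jobs I x m \<noteq> {} \<longrightarrow>
        mach_load I x m - jsize I (least_liked_job I x m) < capacity I m)"

definition relaxed_unsplit_stable :: "('j, 'm) alloc_instance \<Rightarrow> ('j \<times> 'm \<Rightarrow> real) \<Rightarrow> bool" where
  "relaxed_unsplit_stable I x \<longleftrightarrow>
     relaxed_unsplit I x \<and>
     (\<forall>(j, m)\<in>edges I. x (j, m) = 0 \<longrightarrow>
        (\<exists>m'\<in>assigned_machines I x j. jpref I j m' m) \<or>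
        capacity I m \<le> (\<Sum>j'\<in>{j' \<in> mach_nbrs I m. mpref I m j' j}. x (j', m)))"

definition job_weakly_prefers ::
  "('j, 'm) alloc_instance \<Rightarrow> 'j \<Rightarrow> ('j \<times> 'm \<Rightarrow> real) \<Rightarrow> ('j \<times> 'm \<Rightarrow> real) \<Rightarrow> bool" where
  "job_weakly_prefers I j x1 x2 \<longleftrightarrow>
     (\<exists>m1\<in>assigned_machines I x1 j. \<exists>m2\<in>assigned_machines I x2 j.
        m1 = m2 \<or> jpref I j m1 m2)"

definition differing_jobs ::
  "('j, 'm) alloc_instance \<Rightarrow> 'm \<Rightarrow> ('j \<times> 'm \<Rightarrow> real) \<Rightarrow> ('j \<times> 'm \<Rightarrow> real) \<Rightarrow> 'j set" where
  "differing_jobs I m x1 x2 =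
     {j \<in> mach_nbrs I m. (0 < x1 (j, m)) \<noteq> (0 < x2 (j, m))}"

definition mach_weakly_prefers ::
  "('j, 'm) alloc_instance \<Rightarrow> 'm \<Rightarrow> ('j \<times> 'm \<Rightarrow> real) \<Rightarrow> ('j \<times> 'm \<Rightarrow> real) \<Rightarrow> bool" where
  "mach_weakly_prefers I m x1 x2 \<longleftrightarrow>
     differing_jobs I m x1 x2 = {} \<or>
     (\<exists>j\<in>differing_jobs I m x1 x2.
        (\<forall>j'\<in>differing_jobs I m x1 x2. j' \<noteq> j \<longrightarrow> mpref I m j j') \<and> 0 < x1 (j, m))"

definition job_optimal :: "('j, 'm) alloc_instance \<Rightarrow> ('j \<times> 'm \<Rightarrow> real) \<Rightarrow> bool" where
  "job_optimal I x \<longleftrightarrow>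
     relaxed_unsplit_stable I x \<and>
     (\<forall>y. relaxed_unsplit_stable I y \<longrightarrow> (\<forall>j\<in>jobs I. job_weakly_prefers I j x y))"

definition machine_optimal :: "('j, 'm) alloc_instance \<Rightarrow> ('j \<times> 'm \<Rightarrow> real) \<Rightarrow> bool" where
  "machine_optimal I x \<longleftrightarrow>
     relaxed_unsplit_stable I x \<and>
     (\<forall>y. relaxed_unsplit_stable I y \<longrightarrow> (\<forall>m\<in>machines I. mach_weakly_prefers I m x y))"

end

theory Submission
  imports Defs
begin

text \<open>
  In a stable assignment every job is placed, since the dummy machine never fills up; so stable
  assignments are functions from jobs to machines. If a machine \<open>m\<close> is not full in a stable
  assignment, then every adjacent job placed elsewhere strictly prefers its own machine to \<open>m\<close>.
  Part (ii) is then immediate from job-optimality, and part (i) reduces to showing that the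
  machine-optimal assignment is the worst one for all jobs.

  For this, let every job take the worse of its machines in two stable assignments. The outcome has
  no blocking edge, though machines may be overfull. Moving a superfluous job to its next choice
  preserves the absence of blocking edges, so iterating this yields a stable assignment that is
  weakly worse for all jobs than both given ones. A stable assignment that is weakly worse for all
  jobs is lexicographically weakly better for all machines, so it must agree with the
  machine-optimal one.
\<close>

section \<open>Best elements of finite strict rankings\<close>

text \<open>A transitive irreflexive relation is asymmetric, so a finite nonempty set has a minimal
  element; totality turns "not beaten by" into "beats".\<close>

lemma strict_ranking_on_best:
  assumes "strict_ranking_on A R" "B \<subseteq> A" "finite B" "B \<noteq> {}"
  shows "\<exists>b\<in>B. \<forall>b'\<in>B. b' \<noteq> b \<longrightarrow> R b b'"
proof -
  have R: "irreflp_on B R" "transp_on B R" "totalp_on B R"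
    using assms unfolding strict_ranking_on_def
    by (auto intro: irreflp_on_subset transp_on_subset totalp_on_subset)
  then have "asymp_on B R"
    by (simp add: asymp_on_iff_irreflp_on_if_transp_on)
  then obtain b where b: "b \<in> B" "\<forall>b'\<in>B. b' \<noteq> b \<longrightarrow> \<not> R b' b"
    using Finite_Set.bex_min_element[OF assms(3) _ R(2) assms(4)] by blast
  then show ?thesis
    using R(3) unfolding totalp_on_def by metis
qed

text \<open>Reversing the ranking lets the existence of a best element also yield a least liked
  one.\<close>

lemma strict_ranking_on_conversep:
  "strict_ranking_on A R \<Longrightarrow> strict_ranking_on A (\<lambda>x y. R y x)"
  unfolding strict_ranking_on_def irreflp_on_def transp_on_def totalp_on_def by blast

section \<open>Assignments as functions from jobs to machines\<close>

text \<open>The job \<open>j\<close> need not be placed on \<open>m\<close>: the same set serves the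
  stability condition, where \<open>j\<close> is elsewhere, and the capacity condition, where
  \<open>j\<close> is on \<open>m\<close>.\<close>

definition jobs_above :: "('j, 'm) alloc_instance \<Rightarrow> ('j \<Rightarrow> 'm) \<Rightarrow> 'm \<Rightarrow> 'j \<Rightarrow> 'j set" where
  "jobs_above I f m j = {k \<in> mach_nbrs I m. f k = m \<and> mpref I m k j}"

definition load_above :: "('j, 'm) alloc_instance \<Rightarrow> ('j \<Rightarrow> 'm) \<Rightarrow> 'm \<Rightarrow> 'j \<Rightarrow> real" where
  "load_above I f m j = sum (jsize I) (jobs_above I f m j)"

definition placement :: "('j, 'm) alloc_instance \<Rightarrow> ('j \<Rightarrow> 'm) \<Rightarrow> bool" where
  "placement I f \<longleftrightarrow> (\<forall>j\<in>jobs I. (j, f j) \<in> edges I)"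

definition nonblocking :: "('j, 'm) alloc_instance \<Rightarrow> ('j \<Rightarrow> 'm) \<Rightarrow> bool" where
  "nonblocking I f \<longleftrightarrow> (\<forall>j m. (j, m) \<in> edges I \<longrightarrow> f j \<noteq> m \<longrightarrow>
     jpref I j (f j) m \<or> capacity I m \<le> load_above I f m j)"

text \<open>This is the relaxed capacity condition, asked of every job on a machine instead of only
  the least liked one, which avoids a definite description.\<close>

definition not_overfull :: "('j, 'm) alloc_instance \<Rightarrow> ('j \<Rightarrow> 'm) \<Rightarrow> bool" where
  "not_overfull I f \<longleftrightarrow> (\<forall>j\<in>jobs I. load_above I f (f j) j < capacity I (f j))"

definition stable_placement :: "('j, 'm) alloc_instance \<Rightarrow> ('j \<Rightarrow> 'm) \<Rightarrow> bool" where
  "stable_placement I f \<longleftrightarrow> placement I f \<and> nonblocking I f \<and> not_overfull I f"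

text \<open>The first placement is the one that the jobs like less. Values outside
  \<open>jobs I\<close> are arbitrary and not compared.\<close>

definition weakly_worse :: "('j, 'm) alloc_instance \<Rightarrow> ('j \<Rightarrow> 'm) \<Rightarrow> ('j \<Rightarrow> 'm) \<Rightarrow> bool" where
  "weakly_worse I g f \<longleftrightarrow> (\<forall>j\<in>jobs I. g j = f j \<or> jpref I j (f j) (g j))"

definition represents :: "('j, 'm) alloc_instance \<Rightarrow> ('j \<Rightarrow> 'm) \<Rightarrow> ('j \<times> 'm \<Rightarrow> real) \<Rightarrow> bool" where
  "represents I f x \<longleftrightarrow> placement I f \<and>
     (\<forall>j m. (j, m) \<in> edges I \<longrightarrow> x (j, m) = (if f j = m then jsize I j else 0))"

section \<open>Basic facts about an instance\<close>

locale allocation =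
  fixes I :: "('j, 'm) alloc_instance"
  assumes valid: "valid_instance I"
begin

lemma finite_jobs: "finite (jobs I)"
  and finite_machines: "finite (machines I)"
  and edge_job: "(j, m) \<in> edges I \<Longrightarrow> j \<in> jobs I"
  and edge_machine: "(j, m) \<in> edges I \<Longrightarrow> m \<in> machines I"
  and jsize_pos: "j \<in> jobs I \<Longrightarrow> 0 < jsize I j"
  and job_ranking: "j \<in> jobs I \<Longrightarrow> strict_ranking_on (job_nbrs I j) (jpref I j)"
  and mach_ranking: "m \<in> machines I \<Longrightarrow> strict_ranking_on (mach_nbrs I m) (mpref I m)"
  and dummy_edge: "j \<in> jobs I \<Longrightarrow> (j, dummy I) \<in> edges I"
  and dummy_last: "(j, m) \<in> edges I \<Longrightarrow> m \<noteq> dummy I \<Longrightarrow> jpref I j m (dummy I)"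
  and dummy_capacity: "sum (jsize I) (jobs I) < capacity I (dummy I)"
  using valid unfolding valid_instance_def job_nbrs_def by auto

lemma finite_mach_nbrs: "finite (mach_nbrs I m)"
  by (rule finite_subset[OF _ finite_jobs]) (auto simp: mach_nbrs_def dest: edge_job)

lemma finite_job_nbrs: "finite (job_nbrs I j)"
  by (rule finite_subset[OF _ finite_machines]) (auto simp: job_nbrs_def dest: edge_machine)

lemma jpref_irrefl: "(j, m) \<in> edges I \<Longrightarrow> \<not> jpref I j m m"
  using job_ranking[of j] edge_job[of j m]
  by (auto simp: strict_ranking_on_def irreflp_on_def job_nbrs_def)

lemma jpref_trans:
  "(j, a) \<in> edges I \<Longrightarrow> (j, b) \<in> edges I \<Longrightarrow> (j, c) \<in> edges I \<Longrightarrow>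
   jpref I j a b \<Longrightarrow> jpref I j b c \<Longrightarrow> jpref I j a c"
  using job_ranking[of j] edge_job[of j a]
  unfolding strict_ranking_on_def transp_on_def job_nbrs_def by blast

lemma jpref_total:
  "(j, a) \<in> edges I \<Longrightarrow> (j, b) \<in> edges I \<Longrightarrow> a \<noteq> b \<Longrightarrow> jpref I j a b \<or> jpref I j b a"
  using job_ranking[of j] edge_job[of j a]
  unfolding strict_ranking_on_def totalp_on_def job_nbrs_def by blast

lemma mpref_irrefl: "(j, m) \<in> edges I \<Longrightarrow> \<not> mpref I m j j"
  using mach_ranking[of m] edge_machine[of j m]
  by (auto simp: strict_ranking_on_def irreflp_on_def mach_nbrs_def)

lemma mpref_trans:
  "(a, m) \<in> edges I \<Longrightarrow> (b, m) \<in> edges I \<Longrightarrow> (c, m) \<in> edges I \<Longrightarrow>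
   mpref I m a b \<Longrightarrow> mpref I m b c \<Longrightarrow> mpref I m a c"
  using mach_ranking[of m] edge_machine[of a m]
  unfolding strict_ranking_on_def transp_on_def mach_nbrs_def by blast

lemma mem_jobs_above:
  "k \<in> jobs_above I f m j \<longleftrightarrow> (k, m) \<in> edges I \<and> f k = m \<and> mpref I m k j"
  by (simp add: jobs_above_def mach_nbrs_def)

lemma sum_jsize_mono:
  assumes "A \<subseteq> B" "B \<subseteq> jobs I"
  shows "sum (jsize I) A \<le> sum (jsize I) B"
  using assms finite_subset[OF assms(2) finite_jobs]
  by (intro sum_mono2) (auto dest!: jsize_pos intro: less_imp_le)

lemma jobs_above_subset: "jobs_above I f m j \<subseteq> jobs I"
  by (auto simp: mem_jobs_above dest: edge_job)

lemma load_above_mono: "jobs_above I f m j \<subseteq> jobs_above I g m k \<Longrightarrow> load_above I f m j \<le> load_above I g m k"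
  unfolding load_above_def by (rule sum_jsize_mono[OF _ jobs_above_subset])

lemma jobs_above_trans:
  assumes "(j, m) \<in> edges I" "(k, m) \<in> edges I" "mpref I m k j"
  shows "jobs_above I f m k \<subseteq> jobs_above I f m j"
  using mpref_trans[OF _ assms(2,1) _ assms(3)] by (auto simp: mem_jobs_above)

text \<open>All jobs together are too small to fill the dummy machine, so a job displaced from
  another machine can always fall back on it.\<close>

lemma load_above_dummy: "load_above I f (dummy I) j < capacity I (dummy I)"
  using sum_jsize_mono[OF jobs_above_subset order_refl, of f "dummy I" j] dummy_capacity
  by (simp add: load_above_def)

lemma not_overfullD:
  "not_overfull I f \<Longrightarrow> (j, m) \<in> edges I \<Longrightarrow> f j = m \<Longrightarrow> load_above I f m j < capacity I m"
  using edge_job by (auto simp: not_overfull_def)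

section \<open>Translation between assignments and placements\<close>

lemma represents_pos:
  assumes "represents I f x" "(j, m) \<in> edges I"
  shows "0 < x (j, m) \<longleftrightarrow> f j = m"
  using assms jsize_pos[OF edge_job[OF assms(2)]] by (auto simp: represents_def)

lemma represents_assigned_jobs:
  "represents I f x \<Longrightarrow> assigned_jobs I x m = {j \<in> mach_nbrs I m. f j = m}"
  by (auto simp: assigned_jobs_def mach_nbrs_def represents_pos)

lemma represents_assigned_machines:
  assumes "represents I f x" "j \<in> jobs I"
  shows "assigned_machines I x j = {f j}"
proof -
  have "(j, f j) \<in> edges I" using assms by (auto simp: represents_def placement_def)
  then show ?thesis using assms
    by (auto simp: assigned_machines_def job_nbrs_def represents_pos)
qed

lemma represents_sum:
  assumes "represents I f x"
  shows "(\<Sum>j\<in>{j \<in> mach_nbrs I m. P j}. x (j, m)) =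
    sum (jsize I) {j \<in> mach_nbrs I m. f j = m \<and> P j}"
proof -
  have "(\<Sum>j\<in>{j \<in> mach_nbrs I m. P j}. x (j, m)) =
      (\<Sum>j\<in>{j \<in> mach_nbrs I m. P j}. if f j = m then jsize I j else 0)"
    using assms by (intro sum.cong) (auto simp: represents_def mach_nbrs_def)
  also have "\<dots> = sum (jsize I) ({j \<in> mach_nbrs I m. P j} \<inter> {j. f j = m})"
    by (subst sum.inter_restrict) (auto simp: finite_mach_nbrs)
  also have "{j \<in> mach_nbrs I m. P j} \<inter> {j. f j = m} = {j \<in> mach_nbrs I m. f j = m \<and> P j}"
    by auto
  finally show ?thesis .
qed

lemma represents_load_above:
  assumes "represents I f x"
  shows "(\<Sum>k\<in>{k \<in> mach_nbrs I m. mpref I m k j}. x (k, m)) = load_above I f m j"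
  using represents_sum[OF assms, of m "\<lambda>k. mpref I m k j"]
  by (simp add: load_above_def jobs_above_def)

lemma represents_mach_load:
  assumes "represents I f x"
  shows "mach_load I x m = sum (jsize I) {j \<in> mach_nbrs I m. f j = m}"
  using represents_sum[OF assms, of m "\<lambda>_. True"] by (simp add: mach_load_def)

text \<open>Asymmetry of the ranking makes the worst assigned job unique, so the definite
  description denotes it.\<close>

lemma least_liked_job:
  assumes "m \<in> machines I" "assigned_jobs I x m \<noteq> {}"
  shows "least_liked_job I x m \<in> assigned_jobs I x m \<and>
    (\<forall>j\<in>assigned_jobs I x m. j \<noteq> least_liked_job I x m \<longrightarrow>
       mpref I m j (least_liked_job I x m))"
proof -
  have sub: "assigned_jobs I x m \<subseteq> mach_nbrs I m" by (auto simp: assigned_jobs_def)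
  obtain b where b: "b \<in> assigned_jobs I x m"
    "\<forall>j\<in>assigned_jobs I x m. j \<noteq> b \<longrightarrow> mpref I m j b"
    using strict_ranking_on_best[OF strict_ranking_on_conversep[OF mach_ranking[OF assms(1)]] sub
        finite_subset[OF sub finite_mach_nbrs] assms(2)] by blast
  have unique: "c = b" if c: "c \<in> assigned_jobs I x m"
    "\<forall>j\<in>assigned_jobs I x m. j \<noteq> c \<longrightarrow> mpref I m j c" for c
  proof (rule ccontr)
    assume "c \<noteq> b"
    then have "mpref I m b c" "mpref I m c b" using b c by auto
    moreover have "(b, m) \<in> edges I" "(c, m) \<in> edges I"
      using b c sub by (auto simp: mach_nbrs_def)
    ultimately show False using mpref_trans mpref_irrefl by blast
  qed
  have "least_liked_job I x m = b"
    unfolding least_liked_job_def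
    by (rule the_equality, rule conjI[OF b], elim conjE, rule unique)
  then show ?thesis using b by simp
qed

text \<open>The jobs on \<open>m\<close> are the least liked one together with those that
  \<open>m\<close> ranks above it, and irreflexivity makes this union disjoint.\<close>

lemma mach_load_minus_least_liked:
  assumes r: "represents I f x" and m: "m \<in> machines I" and ne: "assigned_jobs I x m \<noteq> {}"
  shows "mach_load I x m - jsize I (least_liked_job I x m) =
    load_above I f m (least_liked_job I x m)"
proof -
  let ?l = "least_liked_job I x m"
  note l = least_liked_job[OF m ne, unfolded represents_assigned_jobs[OF r]]
  have irr: "\<not> mpref I m ?l ?l" using l mpref_irrefl by (auto simp: mach_nbrs_def)
  have eq: "{j \<in> mach_nbrs I m. f j = m} = insert ?l (jobs_above I f m ?l)"
    using l by (auto simp: jobs_above_def)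
  have "?l \<notin> jobs_above I f m ?l" using irr by (simp add: mem_jobs_above)
  then show ?thesis
    unfolding represents_mach_load[OF r] eq load_above_def
    using finite_subset[OF jobs_above_subset finite_jobs] by simp
qed

text \<open>Among the jobs on a machine, the load above a job is largest for the least liked one, so
  the bound there gives the bound for all; the converse is the instance at that job.\<close>

lemma relaxed_iff_not_overfull:
  assumes r: "represents I f x"
  shows "(\<forall>m\<in>machines I. assigned_jobs I x m \<noteq> {} \<longrightarrow>
      mach_load I x m - jsize I (least_liked_job I x m) < capacity I m) \<longleftrightarrow> not_overfull I f"
    (is "?L \<longleftrightarrow> _")
proof
  assume L: ?L
  show "not_overfull I f"
    unfolding not_overfull_def
  proof
    fix j assume j: "j \<in> jobs I"
    let ?m = "f j" and ?l = "least_liked_job I x (f j)"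
    have e: "(j, ?m) \<in> edges I" using r j by (auto simp: represents_def placement_def)
    have m: "?m \<in> machines I" by (rule edge_machine[OF e])
    have ja: "j \<in> assigned_jobs I x ?m"
      using e by (simp add: represents_assigned_jobs[OF r] mach_nbrs_def)
    then have ne: "assigned_jobs I x ?m \<noteq> {}" by auto
    note l = least_liked_job[OF m ne]
    have le: "(?l, ?m) \<in> edges I" using l by (auto simp: assigned_jobs_def mach_nbrs_def)
    have "load_above I f ?m j \<le> load_above I f ?m ?l"
      using l ja jobs_above_trans[OF le e] by (cases "j = ?l") (auto intro: load_above_mono)
    also have "\<dots> < capacity I ?m"
      using L m ne mach_load_minus_least_liked[OF r m ne] by fastforce
    finally show "load_above I f ?m j < capacity I ?m" .
  qed
next
  assume no: "not_overfull I f"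
  show ?L
  proof (intro ballI impI)
    fix m assume m: "m \<in> machines I" and ne: "assigned_jobs I x m \<noteq> {}"
    let ?l = "least_liked_job I x m"
    have "?l \<in> mach_nbrs I m" "f ?l = m"
      using least_liked_job[OF m ne] by (auto simp: represents_assigned_jobs[OF r])
    then have "load_above I f m ?l < capacity I m"
      using no not_overfullD by (simp add: mach_nbrs_def)
    then show "mach_load I x m - jsize I ?l < capacity I m"
      by (simp add: mach_load_minus_least_liked[OF r m ne])
  qed
qed

lemma represents_unsplit:
  assumes r: "represents I f x"
  shows "unsplit I x"
proof -
  have "job_load I x j = jsize I j" if j: "j \<in> jobs I" for j
  proof -
    have "f j \<in> job_nbrs I j"
      using r j by (auto simp: represents_def placement_def job_nbrs_def)
    moreover have "job_load I x j = (\<Sum>m\<in>job_nbrs I j. if f j = m then jsize I j else 0)"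
      unfolding job_load_def using r
      by (intro sum.cong) (auto simp: represents_def job_nbrs_def)
    ultimately show ?thesis by (simp add: finite_job_nbrs)
  qed
  moreover have "0 \<le> x e" if "e \<in> edges I" for e
    using that r jsize_pos edge_job by (cases e) (fastforce simp: represents_def)
  ultimately show ?thesis
    using r by (auto simp: unsplit_def is_assignment_def represents_def)
qed

text \<open>The bridge that lets the later arguments work with placements alone.\<close>

lemma represents_stable_iff:
  assumes r: "represents I f x"
  shows "relaxed_unsplit_stable I x \<longleftrightarrow> stable_placement I f"
proof -
  have "(\<forall>(j, m)\<in>edges I. x (j, m) = 0 \<longrightarrow>
      (\<exists>m'\<in>assigned_machines I x j. jpref I j m' m) \<or>
      capacity I m \<le> (\<Sum>j'\<in>{j' \<in> mach_nbrs I m. mpref I m j' j}. x (j', m))) \<longleftrightarrow>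
    nonblocking I f"
  proof -
    have z: "x (j, m) = 0 \<longleftrightarrow> f j \<noteq> m" if "(j, m) \<in> edges I" for j m
      using r that jsize_pos[OF edge_job[OF that]] by (auto simp: represents_def)
    show ?thesis
      unfolding nonblocking_def represents_load_above[OF r]
      using z represents_assigned_machines[OF r edge_job] by fastforce
  qed
  then show ?thesis
    using r represents_unsplit[OF r]
    by (simp add: relaxed_unsplit_stable_def relaxed_unsplit_def stable_placement_def
        relaxed_iff_not_overfull[OF r] represents_def conj_commute)
qed

text \<open>Two positive edges would each carry the full size of \<open>j\<close>, giving it a load
  of twice its positive size.\<close>

lemma unsplit_assigned_unique:
  assumes u: "unsplit I x" and a: "a \<in> assigned_machines I x j" and b: "b \<in> assigned_machines I x j"
  shows "a = b"
proof (rule ccontr)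
  assume "a \<noteq> b"
  have e: "(j, a) \<in> edges I" "(j, b) \<in> edges I" and pos: "0 < x (j, a)" "0 < x (j, b)"
    using a b by (auto simp: assigned_machines_def job_nbrs_def)
  have j: "j \<in> jobs I" using edge_job[OF e(1)] .
  have "x (j, a) \<in> {0, jsize I j}" "x (j, b) \<in> {0, jsize I j}"
    using u e by (auto simp: unsplit_def)
  then have "2 * jsize I j = (\<Sum>m\<in>{a, b}. x (j, m))"
    using pos \<open>a \<noteq> b\<close> by auto
  also have "\<dots> \<le> job_load I x j"
    unfolding job_load_def using e u finite_job_nbrs
    by (intro sum_mono2) (auto simp: job_nbrs_def unsplit_def is_assignment_def)
  also have "\<dots> \<le> jsize I j" using u j by (auto simp: unsplit_def)
  finally show False using jsize_pos[OF j] by simp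
qed

lemma stable_assigned:
  assumes s: "relaxed_unsplit_stable I x" and j: "j \<in> jobs I"
  shows "assigned_machines I x j \<noteq> {}"
proof
  assume none: "assigned_machines I x j = {}"
  let ?d = "dummy I"
  have u: "unsplit I x" using s by (simp add: relaxed_unsplit_stable_def relaxed_unsplit_def)
  have "0 \<le> x (j, ?d)" "\<not> 0 < x (j, ?d)"
    using none u dummy_edge[OF j]
    by (auto simp: assigned_machines_def job_nbrs_def unsplit_def is_assignment_def)
  then have "capacity I ?d \<le> (\<Sum>k\<in>{k \<in> mach_nbrs I ?d. mpref I ?d k j}. x (k, ?d))"
    using s dummy_edge[OF j] none by (fastforce simp: relaxed_unsplit_stable_def)
  also have "\<dots> \<le> (\<Sum>k\<in>{k \<in> mach_nbrs I ?d. mpref I ?d k j}. jsize I k)"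
  proof (rule sum_mono)
    fix k assume "k \<in> {k \<in> mach_nbrs I ?d. mpref I ?d k j}"
    then have e: "(k, ?d) \<in> edges I" by (simp add: mach_nbrs_def)
    then have "x (k, ?d) \<in> {0, jsize I k}" using u by (auto simp: unsplit_def)
    then show "x (k, ?d) \<le> jsize I k" using jsize_pos[OF edge_job[OF e]] by auto
  qed
  also have "\<dots> \<le> sum (jsize I) (jobs I)"
    by (rule sum_jsize_mono) (auto simp: mach_nbrs_def dest: edge_job)
  finally show False using dummy_capacity by simp
qed

lemma stable_representation:
  assumes s: "relaxed_unsplit_stable I x"
  obtains f where "represents I f x" "stable_placement I f"
proof -
  have u: "unsplit I x" using s by (simp add: relaxed_unsplit_stable_def relaxed_unsplit_def)
  \<comment> \<open>On jobs the choice is forced, since the assigned machine exists and is unique.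
    Off \<open>jobs I\<close> there are no edges, so the value is harmless.\<close>
  define f where "f j = (SOME m. m \<in> assigned_machines I x j)" for j
  have f: "f j \<in> assigned_machines I x j" if "j \<in> jobs I" for j
    using stable_assigned[OF s that] by (simp add: f_def some_in_eq)
  have "x (j, m) = (if f j = m then jsize I j else 0)" if e: "(j, m) \<in> edges I" for j m
  proof -
    have v: "x (j, m) \<in> {0, jsize I j}" using u e by (auto simp: unsplit_def)
    have fj: "f j \<in> assigned_machines I x j" by (rule f[OF edge_job[OF e]])
    show ?thesis
    proof (cases "f j = m")
      case True
      then show ?thesis using fj v by (auto simp: assigned_machines_def)
    next
      case False
      then have "m \<notin> assigned_machines I x j"
        using unsplit_assigned_unique[OF u fj] by auto
      then show ?thesis
        using False v e jsize_pos[OF edge_job[OF e]]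
        by (auto simp: assigned_machines_def job_nbrs_def)
    qed
  qed
  moreover have "placement I f"
    using f by (auto simp: placement_def assigned_machines_def job_nbrs_def)
  ultimately have "represents I f x" by (auto simp: represents_def)
  then show thesis using that represents_stable_iff s by blast
qed

lemma represents_of_placement:
  "placement I f \<Longrightarrow> represents I f (\<lambda>(j, m). if f j = m then jsize I j else 0)"
  by (simp add: represents_def)

text \<open>The job moves to its best machine below \<open>f j\<close>. Only \<open>f j\<close>
  loses a job, and the jobs it ranks above \<open>j\<close> fill it by themselves, so no job gains a
  reason to block there.\<close>

lemma nonblocking_demote:
  assumes p: "placement I f" and n: "nonblocking I f" and j: "j \<in> jobs I"
    and full: "capacity I (f j) \<le> load_above I f (f j) j"
  obtains m where "(j, m) \<in> edges I" "jpref I j (f j) m" "nonblocking I (f(j := m))"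
proof -
  define W where "W = {m \<in> job_nbrs I j. jpref I j (f j) m}"
  have e0: "(j, f j) \<in> edges I" using p j by (auto simp: placement_def)
  have "f j \<noteq> dummy I" using full load_above_dummy[of f j] by auto
  then have "dummy I \<in> W"
    using dummy_last[OF e0] dummy_edge[OF j] by (auto simp: W_def job_nbrs_def)
  then have ne: "W \<noteq> {}" by auto
  have sub: "W \<subseteq> job_nbrs I j" by (auto simp: W_def)
  obtain m1 where m1: "m1 \<in> W" "\<forall>m\<in>W. m \<noteq> m1 \<longrightarrow> jpref I j m1 m"
    using strict_ranking_on_best[OF job_ranking[OF j] sub finite_subset[OF sub finite_job_nbrs] ne]
    by blast
  have e1: "(j, m1) \<in> edges I" and pref1: "jpref I j (f j) m1"
    using m1(1) by (auto simp: W_def job_nbrs_def)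
  let ?g = "f(j := m1)"
  \<comment> \<open>Moving \<open>j\<close> cannot shrink a set of jobs above \<open>j\<close>,
    because \<open>j\<close> is never above itself.\<close>
  have self: "jobs_above I f m j \<subseteq> jobs_above I ?g m j" for m
    using mpref_irrefl by (auto simp: mem_jobs_above)
  have "nonblocking I ?g"
    unfolding nonblocking_def
  proof (intro allI impI)
    fix k m assume e: "(k, m) \<in> edges I" and km: "?g k \<noteq> m"
    show "jpref I k (?g k) m \<or> capacity I m \<le> load_above I ?g m k"
    proof (cases "k = j")
      case True
      show ?thesis
      proof (cases "m \<in> W")
        case True
        then show ?thesis using m1(2) km \<open>k = j\<close> by auto
      next
        case False
        \<comment> \<open>Either \<open>m\<close> is the machine just left, full above
          \<open>j\<close> by assumption, or \<open>j\<close> liked it better than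
          \<open>f j\<close> and it was full above \<open>j\<close> because \<open>f\<close> has no
          blocking edge.\<close>
        then have nw: "\<not> jpref I j (f j) m" using e \<open>k = j\<close> by (auto simp: W_def job_nbrs_def)
        have "capacity I m \<le> load_above I f m j"
          using n full nw e \<open>k = j\<close> by (cases "m = f j") (auto simp: nonblocking_def)
        then show ?thesis using load_above_mono[OF self, of m] \<open>k = j\<close> by simp
      qed
    next
      case False
      then have gk: "?g k = f k" by simp
      show ?thesis
      proof (cases "jpref I k (f k) m")
        case True
        then show ?thesis using gk by simp
      next
        case npref: False
        then have full_k: "capacity I m \<le> load_above I f m k"
          using n e km gk by (auto simp: nonblocking_def)
        show ?thesis
        \<comment> \<open>Only in this case does the load above \<open>k\<close> lose
          \<open>j\<close>; then everything above \<open>j\<close> is also above \<open>k\<close>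
          and already suffices to fill \<open>m\<close>.\<close>
        proof (cases "m = f j \<and> mpref I m j k")
          case True
          then have "jobs_above I ?g m j \<subseteq> jobs_above I ?g m k"
            using e0 e by (intro jobs_above_trans) auto
          then have "load_above I f m j \<le> load_above I ?g m k"
            using self[of m] by (intro load_above_mono) auto
          then show ?thesis using full True by simp
        next
          case False
          then have "jobs_above I f m k \<subseteq> jobs_above I ?g m k" by (auto simp: mem_jobs_above)
          then show ?thesis using order_trans[OF full_k load_above_mono] by blast
        qed
      qed
    qed
  qed
  then show thesis using that e1 pref1 by blast
qed

lemma stable_below_nonblocking:
  assumes "placement I f" "nonblocking I f"
  shows "\<exists>g. stable_placement I g \<and> weakly_worse I g f"
  using assms
\<comment> \<open>The measure counts, over all jobs, the machines still below the current one; each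
  demotion lowers it strictly.\<close>
proof (induction "\<Sum>j\<in>jobs I. card {m \<in> job_nbrs I j. jpref I j (f j) m}"
    arbitrary: f rule: less_induct)
  case less
  show ?case
  proof (cases "not_overfull I f")
    case True
    then show ?thesis using less.prems by (auto simp: stable_placement_def weakly_worse_def)
  next
    case False
    then obtain j where j: "j \<in> jobs I" and full: "capacity I (f j) \<le> load_above I f (f j) j"
      by (auto simp: not_overfull_def not_less)
    obtain m where m: "(j, m) \<in> edges I" "jpref I j (f j) m" "nonblocking I (f(j := m))"
      using nonblocking_demote[OF less.prems j full] .
    let ?g = "f(j := m)"
    have e: "(j, f j) \<in> edges I" using less.prems j by (auto simp: placement_def)
    have "{m' \<in> job_nbrs I j. jpref I j m m'} \<subset> {m' \<in> job_nbrs I j. jpref I j (f j) m'}"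
      using m jpref_trans[OF e m(1) _ m(2)] jpref_irrefl[OF m(1)] by (auto simp: job_nbrs_def)
    then have lt: "card {m' \<in> job_nbrs I j. jpref I j (?g j) m'}
        < card {m' \<in> job_nbrs I j. jpref I j (f j) m'}"
      by (intro psubset_card_mono) (auto simp: finite_job_nbrs)
    have "(\<Sum>k\<in>jobs I. card {m' \<in> job_nbrs I k. jpref I k (?g k) m'})
        < (\<Sum>k\<in>jobs I. card {m' \<in> job_nbrs I k. jpref I k (f k) m'})"
    proof (rule sum_strict_mono_ex1[OF finite_jobs])
      show "\<forall>k\<in>jobs I. card {m' \<in> job_nbrs I k. jpref I k (?g k) m'}
          \<le> card {m' \<in> job_nbrs I k. jpref I k (f k) m'}"
      proof
        fix k
        show "card {m' \<in> job_nbrs I k. jpref I k (?g k) m'}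
          \<le> card {m' \<in> job_nbrs I k. jpref I k (f k) m'}"
          using lt by (cases "k = j") auto
      qed
    qed (rule bexI[of _ j], rule lt, rule j)
    moreover have pg: "placement I ?g" using less.prems m(1) by (auto simp: placement_def)
    ultimately obtain h where h: "stable_placement I h" "weakly_worse I h ?g"
      using less.hyps m(3) by blast
    have hj: "(j, h j) \<in> edges I" using h(1) j by (auto simp: stable_placement_def placement_def)
    have "h k = f k \<or> jpref I k (f k) (h k)" if "k \<in> jobs I" for k
      using h(2) that m jpref_trans[OF e m(1) hj m(2)]
      by (cases "k = j") (auto simp: weakly_worse_def)
    then show ?thesis using h(1) by (auto simp: weakly_worse_def)
  qed
qed

section \<open>Common lower bounds of stable placements\<close>

text \<open>If some job \<open>k\<close> above \<open>j\<close> leaves \<open>m\<close> when passing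
  from \<open>f\<close> to \<open>y\<close>, it goes to its worse machine under \<open>g\<close>, so
  \<open>m\<close> is full above \<open>k\<close> under \<open>g\<close>. These jobs all stay on
  \<open>m\<close> under \<open>y\<close>, which therefore remains full above \<open>k\<close> and
  hence above \<open>j\<close>.\<close>

lemma full_above_meet:
  assumes f: "stable_placement I f" and g: "stable_placement I g"
    and y: "\<And>j. j \<in> jobs I \<Longrightarrow> y j = f j \<or> y j = g j"
    and yf: "weakly_worse I y f" and yg: "weakly_worse I y g"
    and e: "(j, m) \<in> edges I" and full: "capacity I m \<le> load_above I f m j"
  shows "capacity I m \<le> load_above I y m j"
proof (cases "jobs_above I f m j \<subseteq> jobs_above I y m j")
  case True
  then show ?thesis by (rule order_trans[OF full load_above_mono])
next
  case False
  then obtain k where k: "(k, m) \<in> edges I" "f k = m" "mpref I m k j" "y k \<noteq> m"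
    unfolding subset_iff mem_jobs_above by blast
  have kj: "k \<in> jobs I" by (rule edge_job[OF k(1)])
  have eg: "(k, g k) \<in> edges I" using g kj by (auto simp: stable_placement_def placement_def)
  have gk: "g k \<noteq> m" "jpref I k m (g k)"
    using y[OF kj] yf kj k by (auto simp: weakly_worse_def)
  then have "\<not> jpref I k (g k) m"
    using jpref_trans[OF k(1) eg k(1)] jpref_irrefl[OF k(1)] by blast
  then have gfull: "capacity I m \<le> load_above I g m k"
    using g gk k(1) by (auto simp: stable_placement_def nonblocking_def)
  have "jobs_above I g m k \<subseteq> jobs_above I y m k"
  proof
    fix l assume "l \<in> jobs_above I g m k"
    then have l: "(l, m) \<in> edges I" "g l = m" "mpref I m l k" by (auto simp: mem_jobs_above)
    have lj: "l \<in> jobs I" by (rule edge_job[OF l(1)])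
    have "y l = m"
    \<comment> \<open>If \<open>l\<close> left \<open>m\<close>, its machine under \<open>f\<close>
      would be worse than \<open>m\<close>, so \<open>m\<close> would be full above
      \<open>l\<close>, hence above \<open>k\<close>, under \<open>f\<close>. But \<open>k\<close>
      is on \<open>m\<close> under \<open>f\<close>, which is not overfull.\<close>
    proof (rule ccontr)
      assume yl: "y l \<noteq> m"
      have ef: "(l, f l) \<in> edges I" using f lj by (auto simp: stable_placement_def placement_def)
      have fl: "f l \<noteq> m" "jpref I l m (f l)"
        using y[OF lj] yg lj l yl by (auto simp: weakly_worse_def)
      then have "\<not> jpref I l (f l) m"
        using jpref_trans[OF l(1) ef l(1)] jpref_irrefl[OF l(1)] by blast
      then have "capacity I m \<le> load_above I f m l"
        using f fl l(1) by (auto simp: stable_placement_def nonblocking_def)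
      also have "\<dots> \<le> load_above I f m k"
        by (rule load_above_mono[OF jobs_above_trans[OF k(1) l(1) l(3)]])
      also have "\<dots> < capacity I m"
        using f not_overfullD[of f, OF _ k(1,2)] by (simp add: stable_placement_def)
      finally show False by simp
    qed
    then show "l \<in> jobs_above I y m k" using l by (simp add: mem_jobs_above)
  qed
  also have "\<dots> \<subseteq> jobs_above I y m j" by (rule jobs_above_trans[OF e k(1) k(3)])
  finally show ?thesis by (rule order_trans[OF gfull load_above_mono])
qed

lemma stable_common_lower_bound:
  assumes f: "stable_placement I f" and g: "stable_placement I g"
  obtains h where "stable_placement I h" "weakly_worse I h f" "weakly_worse I h g"
proof -
  define y where "y j = (if jpref I j (f j) (g j) then g j else f j)" for j
  have ef: "(j, f j) \<in> edges I" and eg: "(j, g j) \<in> edges I" if "j \<in> jobs I" for j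
    using f g that by (auto simp: stable_placement_def placement_def)
  have y: "y j = f j \<or> y j = g j" for j by (simp add: y_def)
  have ey: "(j, y j) \<in> edges I" if "j \<in> jobs I" for j
    using ef eg that by (simp add: y_def)
  have yf: "weakly_worse I y f" by (auto simp: weakly_worse_def y_def)
  have yg: "weakly_worse I y g"
    using jpref_total ef eg by (fastforce simp: weakly_worse_def y_def)
  have "nonblocking I y"
    unfolding nonblocking_def
  proof (intro allI impI)
    fix j m assume e: "(j, m) \<in> edges I" and ym: "y j \<noteq> m"
    \<comment> \<open>Whichever of \<open>f\<close> and \<open>g\<close> supplies
      \<open>y j\<close>, its own stability applies to the edge; \<open>full_above_meet\<close>,
      used in both orders, then carries fullness over to \<open>y\<close>.\<close>
    have "jpref I j (y j) m \<or> capacity I m \<le> load_above I f m j \<or>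
        capacity I m \<le> load_above I g m j"
      using y[of j] ym e f g unfolding stable_placement_def nonblocking_def by metis
    then show "jpref I j (y j) m \<or> capacity I m \<le> load_above I y m j"
      using full_above_meet[OF f g _ yf yg e] full_above_meet[OF g f _ yg yf e] y by blast
  qed
  moreover have "placement I y" using ey by (simp add: placement_def)
  ultimately obtain h where h: "stable_placement I h" "weakly_worse I h y"
    using stable_below_nonblocking by blast
  have "weakly_worse I h u" if "weakly_worse I y u" "placement I u" for u
    using that h ey jpref_trans unfolding weakly_worse_def stable_placement_def placement_def
    by metis
  then show thesis
    using that h yf yg f g by (auto simp: stable_placement_def)
qed

section \<open>Machine-optimal means worst for the jobs\<close>

text \<open>It suffices that \<open>f\<close> equals a stable placement \<open>h\<close> below both
  \<open>f\<close> and \<open>g\<close>. Where they differ, the best differing job of a machine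
  contradicts the capacity condition of \<open>f\<close>.\<close>

lemma machine_optimal_job_pessimal:
  assumes mopt: "machine_optimal I x" and r: "represents I f x"
    and f: "stable_placement I f" and g: "stable_placement I g"
  shows "weakly_worse I f g"
proof -
  obtain h where h: "stable_placement I h" "weakly_worse I h f" "weakly_worse I h g"
    using stable_common_lower_bound[OF f g] .
  \<comment> \<open>Machine-optimality speaks of assignments, so \<open>h\<close> is turned back
    into one.\<close>
  define z where "z = (\<lambda>(j, m). if h j = m then jsize I j else 0)"
  have rz: "represents I h z"
    unfolding z_def using h(1) represents_of_placement by (simp add: stable_placement_def)
  have stz: "relaxed_unsplit_stable I z" using represents_stable_iff[OF rz] h(1) by simp
  have "h j = f j" if j: "j \<in> jobs I" for j
  proof (rule ccontr)
    assume neq: "h j \<noteq> f j"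
    let ?m = "f j"
    have e: "(j, ?m) \<in> edges I" using f j by (auto simp: stable_placement_def placement_def)
    have D: "differing_jobs I ?m x z = {k \<in> mach_nbrs I ?m. (f k = ?m) \<noteq> (h k = ?m)}"
      by (auto simp: differing_jobs_def mach_nbrs_def represents_pos[OF r] represents_pos[OF rz])
    have "j \<in> differing_jobs I ?m x z" using e neq by (simp add: D mach_nbrs_def)
    moreover have "mach_weakly_prefers I ?m x z"
      using mopt stz edge_machine[OF e] by (simp add: machine_optimal_def)
    \<comment> \<open>The witness \<open>k\<close> sits on \<open>?m\<close> under \<open>f\<close>
      and on a worse machine under \<open>h\<close>, so stability of \<open>h\<close> makes
      \<open>?m\<close> full above \<open>k\<close>.\<close>
    ultimately obtain k where k: "k \<in> differing_jobs I ?m x z"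
      "\<forall>l\<in>differing_jobs I ?m x z. l \<noteq> k \<longrightarrow> mpref I ?m k l" "0 < x (k, ?m)"
      unfolding mach_weakly_prefers_def by auto
    have ek: "(k, ?m) \<in> edges I" using k(1) by (simp add: D mach_nbrs_def)
    have fk: "f k = ?m" using k(3) represents_pos[OF r ek] by simp
    have hk: "h k \<noteq> ?m" using k(1) fk by (simp add: D)
    have kj: "k \<in> jobs I" by (rule edge_job[OF ek])
    have eh: "(k, h k) \<in> edges I" using h(1) kj by (auto simp: stable_placement_def placement_def)
    have "jpref I k ?m (h k)" using h(2) kj fk hk by (auto simp: weakly_worse_def)
    then have "\<not> jpref I k (h k) ?m"
      using jpref_trans[OF ek eh ek] jpref_irrefl[OF ek] by blast
    then have "capacity I ?m \<le> load_above I h ?m k"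
      using h(1) hk ek by (auto simp: stable_placement_def nonblocking_def)
    \<comment> \<open>Since \<open>k\<close> is the best differing job, \<open>f\<close> and
      \<open>h\<close> agree on \<open>?m\<close> above \<open>k\<close>.\<close>
    also have "\<dots> \<le> load_above I f ?m k"
    proof (rule load_above_mono, rule subsetI)
      fix l assume "l \<in> jobs_above I h ?m k"
      then have l: "(l, ?m) \<in> edges I" "h l = ?m" "mpref I ?m l k" by (auto simp: mem_jobs_above)
      have "f l = ?m"
      proof (rule ccontr)
        assume "f l \<noteq> ?m"
        then have "l \<in> differing_jobs I ?m x z" using l by (simp add: D mach_nbrs_def)
        moreover have "l \<noteq> k" using l hk by auto
        ultimately have "mpref I ?m k l" using k(2) by blast
        then show False using mpref_trans[OF ek l(1) ek] l(3) mpref_irrefl[OF ek] by blast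
      qed
      then show "l \<in> jobs_above I f ?m k" using l by (simp add: mem_jobs_above)
    qed
    also have "\<dots> < capacity I ?m"
      using f not_overfullD[of f, OF _ ek fk] by (simp add: stable_placement_def)
    finally show False by simp
  qed
  then show ?thesis using h(3) by (simp add: weakly_worse_def)
qed

section \<open>Comparing loads on a machine that is not full\<close>

text \<open>A job placed elsewhere by \<open>f\<close> strictly prefers its machine to the non-full
  \<open>m\<close>. As \<open>f\<close> is the worse placement for it, \<open>g\<close> cannot put
  it on \<open>m\<close>, so every job on \<open>m\<close> under \<open>g\<close> is there under
  \<open>f\<close>.\<close>

lemma load_le_of_not_full:
  assumes f: "stable_placement I f" and rf: "represents I f x" and rg: "represents I g y"
    and worse: "weakly_worse I f g" and notfull: "mach_load I x m < capacity I m"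
  shows "mach_load I y m \<le> mach_load I x m"
proof -
  have "f j = m" if e: "(j, m) \<in> edges I" and gj: "g j = m" for j
  proof (rule ccontr)
    assume fj: "f j \<noteq> m"
    have j: "j \<in> jobs I" by (rule edge_job[OF e])
    have ef: "(j, f j) \<in> edges I" using f j by (auto simp: stable_placement_def placement_def)
    have "load_above I f m j \<le> mach_load I x m"
      unfolding load_above_def represents_mach_load[OF rf]
      by (rule sum_jsize_mono) (auto simp: jobs_above_def mach_nbrs_def dest: edge_job)
    then have "jpref I j (f j) m"
      using notfull f fj e unfolding stable_placement_def nonblocking_def by fastforce
    moreover have "jpref I j m (f j)" using worse j gj fj by (auto simp: weakly_worse_def)
    ultimately show False using jpref_trans[OF e ef e] jpref_irrefl[OF e] by blast
  qed
  then show ?thesis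
    unfolding represents_mach_load[OF rf] represents_mach_load[OF rg]
    by (intro sum_jsize_mono) (auto simp: mach_nbrs_def dest: edge_job)
qed

end

theorem theorem5:
  fixes I :: "('j, 'm) alloc_instance"
    and xjopt xmopt :: "'j \<times> 'm \<Rightarrow> real"
    and m :: 'm
  assumes "valid_instance I"
    and "job_optimal I xjopt"
    and "machine_optimal I xmopt"
    and "m \<in> machines I"
  shows "(mach_load I xmopt m < capacity I m \<longrightarrow>
            (\<forall>x. relaxed_unsplit_stable I x \<longrightarrow> mach_load I x m < capacity I m)) \<and>
         (mach_load I xjopt m > capacity I m \<longrightarrow>
            (\<forall>x. relaxed_unsplit_stable I x \<longrightarrow> mach_load I x m \<ge> capacity I m))"
proof -
  interpret allocation I by unfold_locales (rule assms(1))
  obtain fj where fj: "represents I fj xjopt" "stable_placement I fj"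
    using stable_representation assms(2) unfolding job_optimal_def by blast
  obtain fm where fm: "represents I fm xmopt" "stable_placement I fm"
    using stable_representation assms(3) unfolding machine_optimal_def by blast
  have "mach_load I x m < capacity I m"
    if x: "relaxed_unsplit_stable I x" and "mach_load I xmopt m < capacity I m" for x
  proof -
    obtain f where f: "represents I f x" "stable_placement I f"
      using stable_representation[OF x] .
    \<comment> \<open>Here the machine-optimal placement is the one worse for the jobs.\<close>
    have "mach_load I x m \<le> mach_load I xmopt m"
      using load_le_of_not_full[OF fm(2,1) f(1)
          machine_optimal_job_pessimal[OF assms(3) fm f(2)] that(2)] .
    then show ?thesis using that(2) by simp
  qed
  moreover have "mach_load I x m \<ge> capacity I m"
    if x: "relaxed_unsplit_stable I x" and over: "mach_load I xjopt m > capacity I m" for x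
  proof (rule ccontr)
    assume "\<not> mach_load I x m \<ge> capacity I m"
    then have notfull: "mach_load I x m < capacity I m" by simp
    obtain f where f: "represents I f x" "stable_placement I f"
      using stable_representation[OF x] .
    have "\<forall>j\<in>jobs I. job_weakly_prefers I j xjopt x"
      using assms(2) x by (simp add: job_optimal_def)
    then have "weakly_worse I f fj"
      by (auto simp: weakly_worse_def job_weakly_prefers_def
          represents_assigned_machines[OF f(1)] represents_assigned_machines[OF fj(1)])
    \<comment> \<open>Now the arbitrary \<open>x\<close> is the worse and non-full one, compared
      with the job-optimal assignment.\<close>
    then have "mach_load I xjopt m \<le> mach_load I x m"
      using load_le_of_not_full[OF f(2,1) fj(1) _ notfull] by blast
    then show False using over notfull by simp
  qed
  ultimately show ?thesis by blast
qed

end
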